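(* For every finite simple connected graph $G$, $$\psi(G)\le dim(G)+2\,eqdim(G).$$
   Context: All graphs are finite, simple, undirected and connected; $d(x,y)$ denotes the graph distance. A set $S\subseteq V(G)$ is a distance-equalizer set of $G$ if for every two distinct vertices $x,y\in V(G)\setminus S$ there is $w\in S$ with $d(x,w)=d(y,w)$; $eqdim(G)$ is the minimum cardinality of a distance-equalizer set. A set $S\subseteq V(G)$ is a resolving set if for every two distinct vertices $x,y\in V(G)$ there is $v\in S$ with $d(v,x)\ne d(v,y)$; the metric dimension $dim(G)$ is the minimum cardinality of a resolving set. A set $S\subseteq V(G)$ is a doubly resolving set if for every two distinct vertices $x,y\in V(G)$ there are $u,v\in S$ with $d(u,x)-d(u,y)\ne d(v,x)-d(v,y)$; $\psi(G)$ is the minimum cardinality of a doubly resolving set. *)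

theory Defs
  imports "Graph_Theory.Graph_Theory"
begin

text \<open>
  Finite simple undirected graphs are the symmetric, loop-free digraphs without parallel arcs of
  locale \<^locale>\<open>graph\<close>. Distances are only meaningful between vertices joined by a walk;
  otherwise \<open>gdist\<close> is an unspecified natural number.
\<close>

definition gdist :: "('a, 'b) pre_digraph \<Rightarrow> 'a \<Rightarrow> 'a \<Rightarrow> nat" where
  "gdist G u v = (LEAST n. \<exists>p. pre_digraph.awalk G u p v \<and> length p = n)"

definition distance_equalizer :: "('a, 'b) pre_digraph \<Rightarrow> 'a set \<Rightarrow> bool" where
  "distance_equalizer G S \<longleftrightarrow> S \<subseteq> verts G \<and>
    (\<forall>x \<in> verts G - S. \<forall>y \<in> verts G - S. x \<noteq> y \<longrightarrow> (\<exists>w \<in> S. gdist G x w = gdist G y w))"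

definition resolving :: "('a, 'b) pre_digraph \<Rightarrow> 'a set \<Rightarrow> bool" where
  "resolving G S \<longleftrightarrow> S \<subseteq> verts G \<and>
    (\<forall>x \<in> verts G. \<forall>y \<in> verts G. x \<noteq> y \<longrightarrow> (\<exists>v \<in> S. gdist G v x \<noteq> gdist G v y))"

definition doubly_resolving :: "('a, 'b) pre_digraph \<Rightarrow> 'a set \<Rightarrow> bool" where
  "doubly_resolving G S \<longleftrightarrow> S \<subseteq> verts G \<and>
    (\<forall>x \<in> verts G. \<forall>y \<in> verts G. x \<noteq> y \<longrightarrow>
      (\<exists>u \<in> S. \<exists>v \<in> S. int (gdist G u x) - int (gdist G u y) \<noteq> int (gdist G v x) - int (gdist G v y)))"

definition eqdim :: "('a, 'b) pre_digraph \<Rightarrow> nat" where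
  "eqdim G = (LEAST k. \<exists>S. distance_equalizer G S \<and> card S = k)"

definition metric_dim :: "('a, 'b) pre_digraph \<Rightarrow> nat" where
  "metric_dim G = (LEAST k. \<exists>S. resolving G S \<and> card S = k)"

definition psi :: "('a, 'b) pre_digraph \<Rightarrow> nat" where
  "psi G = (LEAST k. \<exists>S. doubly_resolving G S \<and> card S = k)"

text \<open>On walk-connected pairs, \<open>gdist\<close> is the library's shortest-path distance for unit weights.\<close>

lemma gdist_attained:
  assumes "pre_digraph.awalk G u q v"
  shows "\<exists>p. pre_digraph.awalk G u p v \<and> length p = gdist G u v"
  unfolding gdist_def by (rule LeastI_ex) (use assms in blast)

lemma gdist_le: "pre_digraph.awalk G u p v \<Longrightarrow> gdist G u v \<le> length p"
  unfolding gdist_def by (rule Least_le) blast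

lemma (in wf_digraph) \<mu>_unit_eq_gdist:
  assumes "u \<rightarrow>\<^sup>* v"
  shows "\<mu> (\<lambda>_. 1) u v = ereal (real (gdist G u v))"
proof -
  have cost: "awalk_cost (\<lambda>_. 1) p = real (length p)" for p :: "'b list"
    by (induct p) auto
  obtain p where p: "awalk u p v" "length p = gdist G u v"
    using assms gdist_attained by (metis reachable_awalk)
  show ?thesis
    unfolding \<mu>_def
  proof (rule antisym)
    show "(INF p\<in>{p. awalk u p v}. ereal (awalk_cost (\<lambda>_. 1) p)) \<le> ereal (real (gdist G u v))"
      by (rule INF_lower2[of p]) (use p in \<open>auto simp: cost\<close>)
    show "ereal (real (gdist G u v)) \<le> (INF p\<in>{p. awalk u p v}. ereal (awalk_cost (\<lambda>_. 1) p))"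
      by (rule INF_greatest) (auto simp: cost gdist_le)
  qed
qed

text \<open>The whole vertex set has each of the three properties, so all the minima are attained.\<close>

lemma distance_equalizer_verts: "distance_equalizer G (verts G)"
  by (simp add: distance_equalizer_def)

lemma (in graph) gdist_self:
  assumes "x \<in> verts G"
  shows "gdist G x x = 0"
  using gdist_le[of G x "[]" x] assms by (simp add: awalk_Nil_iff)

lemma (in graph) gdist_pos:
  assumes "Digraph_Component.connected G" "x \<in> verts G" "y \<in> verts G" "x \<noteq> y"
  shows "gdist G x y > 0"
proof -
  have "strongly_connected G"
    using assms(1) sym_arcs by (simp add: symmetric_connected_imp_strongly_connected)
  then obtain q where "awalk x q y"
    using assms by (metis reachable_awalk strongly_connected_def)
  then obtain p where "awalk x p y" "length p = gdist G x y"
    using gdist_attained by metis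
  then show ?thesis
    using assms(4) by (cases p) (auto simp: awalk_Nil_iff)
qed

lemma (in graph) doubly_resolving_verts:
  assumes "Digraph_Component.connected G"
  shows "doubly_resolving G (verts G)"
proof -
  have "int (gdist G x x) - int (gdist G x y) \<noteq> int (gdist G y x) - int (gdist G y y)"
    if "x \<in> verts G" "y \<in> verts G" "x \<noteq> y" for x y
    using that gdist_pos[OF assms, of x y] by (simp add: gdist_self)
  then show ?thesis
    unfolding doubly_resolving_def by blast
qed

lemma (in graph) resolving_verts:
  assumes "Digraph_Component.connected G"
  shows "resolving G (verts G)"
proof -
  have "gdist G x x \<noteq> gdist G x y" if "x \<in> verts G" "y \<in> verts G" "x \<noteq> y" for x y
    using that gdist_pos[OF assms, of x y] by (simp add: gdist_self)
  then show ?thesis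
    unfolding resolving_def by blast
qed

end

theory Submission
  imports Defs
begin

text \<open>
  Let \<open>R\<close> be a minimum resolving set and \<open>S\<close> a minimum distance-equalizer set. For two distinct vertices
  outside \<open>S\<close>, some \<open>v \<in> R\<close> sees them at different distances and some \<open>w \<in> S\<close> sees them at equal
  distances, so \<open>v\<close> and \<open>w\<close> doubly resolve them. Two distinct vertices of \<open>S\<close> doubly resolve each other.
  Hence \<open>R \<union> S\<close> can only fail on a pair \<open>x, y\<close> with \<open>x \<in> S\<close> and \<open>y \<notin> S\<close>.

  For each \<open>x \<in> S\<close> there is at most one such \<open>y\<close>. Failing on \<open>x, y\<close> means that the difference of
  the distances to \<open>x\<close> and to \<open>y\<close> is the same for all vertices of \<open>R \<union> S\<close>. This relation is
  transitive, so if \<open>R \<union> S\<close> failed on both \<open>x, y\<close> and \<open>x, y'\<close>, it would also fail on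
  \<open>y, y'\<close>, two distinct vertices outside \<open>S\<close>. Adding to \<open>R \<union> S\<close> the bad partner of each \<open>x \<in> S\<close>, if there is one,
  costs at most \<open>card S\<close> more vertices. Every bad pair now lies inside the new set and
  resolves itself, and the new set has at most \<open>card R + 2 * card S\<close> elements.
\<close>

definition doubly_separates :: "('a, 'b) pre_digraph \<Rightarrow> 'a set \<Rightarrow> 'a \<Rightarrow> 'a \<Rightarrow> bool" where
  "doubly_separates G T x y \<longleftrightarrow> (\<exists>u \<in> T. \<exists>v \<in> T.
     int (gdist G u x) - int (gdist G u y) \<noteq> int (gdist G v x) - int (gdist G v y))"

lemma doubly_resolving_iff:
  "doubly_resolving G T \<longleftrightarrow> T \<subseteq> verts G \<and>
    (\<forall>x \<in> verts G. \<forall>y \<in> verts G. x \<noteq> y \<longrightarrow> doubly_separates G T x y)"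
  unfolding doubly_resolving_def doubly_separates_def ..

lemma doubly_separates_mono:
  "doubly_separates G T x y \<Longrightarrow> T \<subseteq> U \<Longrightarrow> doubly_separates G U x y"
  unfolding doubly_separates_def by blast

lemma doubly_separates_sym: "doubly_separates G T x y \<Longrightarrow> doubly_separates G T y x"
  unfolding doubly_separates_def by (simp add: algebra_simps) metis

lemma not_doubly_separates_trans:
  assumes "\<not> doubly_separates G T x y" "\<not> doubly_separates G T y z"
  shows "\<not> doubly_separates G T x z"
proof -
  have "int (gdist G u x) - int (gdist G u z) = int (gdist G v x) - int (gdist G v z)"
    if "u \<in> T" "v \<in> T" for u v
  proof -
    have "int (gdist G u x) - int (gdist G u y) = int (gdist G v x) - int (gdist G v y)"
      "int (gdist G u y) - int (gdist G u z) = int (gdist G v y) - int (gdist G v z)"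
      using assms that unfolding doubly_separates_def by blast+
    then show ?thesis by linarith
  qed
  then show ?thesis unfolding doubly_separates_def by blast
qed

context graph
begin

lemma awalk_reverse:
  assumes "awalk u p v"
  shows "\<exists>q. awalk v q u \<and> length q = length p"
  using assms
proof (induction p arbitrary: u)
  case Nil
  then show ?case by (intro exI[of _ "[]"]) (auto simp: awalk_Nil_iff)
next
  case (Cons e p)
  then have e: "e \<in> arcs G" "tail G e = u" and p: "awalk (head G e) p v"
    by (auto simp: awalk_Cons_iff)
  obtain q where q: "awalk v q (head G e)" "length q = length p"
    using Cons.IH[OF p] by blast
  have "(head G e, u) \<in> arcs_ends G"
    using e sym_arcs in_arcs_imp_in_arcs_ends[OF e(1)] by (auto simp: symmetric_def dest: symD)
  then obtain e' where e': "e' \<in> arcs G" "tail G e' = head G e" "head G e' = u"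
    by (auto simp: arcs_ends_def arc_to_ends_def)
  have "awalk (head G e) [e'] u"
    using e' arc_implies_awalk by metis
  then have "awalk v (q @ [e']) u"
    using q(1) by (rule awalk_appendI[rotated])
  then show ?case using q(2) by (intro exI[of _ "q @ [e']"]) simp
qed

text \<open>Equalizing compares distances measured towards \<open>S\<close>, resolving compares distances measured
  from the set; symmetry lets the two be combined.\<close>

lemma gdist_sym: "gdist G u v = gdist G v u"
proof -
  have "(\<exists>p. awalk u p v \<and> length p = n) \<longleftrightarrow> (\<exists>p. awalk v p u \<and> length p = n)" for n
    using awalk_reverse by metis
  then show ?thesis unfolding gdist_def by simp
qed

lemma doubly_separates_members:
  assumes "Digraph_Component.connected G" "T \<subseteq> verts G" "x \<in> T" "y \<in> T" "x \<noteq> y"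
  shows "doubly_separates G T x y"
proof -
  have "x \<in> verts G" "y \<in> verts G" using assms by auto
  then have "int (gdist G x x) - int (gdist G x y) \<noteq> int (gdist G y x) - int (gdist G y y)"
    using gdist_pos[OF assms(1), of x y] assms(5) by (simp add: gdist_self)
  then show ?thesis using assms(3,4) unfolding doubly_separates_def by blast
qed

lemma resolving_equalizer_separates:
  assumes "resolving G R" "distance_equalizer G S"
    and "x \<in> verts G - S" "y \<in> verts G - S" "x \<noteq> y"
  shows "doubly_separates G (R \<union> S) x y"
proof -
  obtain v where v: "v \<in> R" "gdist G v x \<noteq> gdist G v y"
    using assms unfolding resolving_def by blast
  obtain w where w: "w \<in> S" "gdist G x w = gdist G y w"
    using assms unfolding distance_equalizer_def by blast
  have "int (gdist G v x) - int (gdist G v y) \<noteq> int (gdist G w x) - int (gdist G w y)"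
    using v w gdist_sym[of x w] gdist_sym[of y w] by simp
  then show ?thesis using v(1) w(1) unfolding doubly_separates_def by blast
qed

text \<open>Two bad partners \<open>y, z\<close> of the same vertex \<open>x\<close> would form, by transitivity, a pair outside \<open>S\<close>
  that \<open>R \<union> S\<close> does not separate.\<close>

lemma bad_partner_unique:
  assumes "resolving G R" "distance_equalizer G S"
    and "y \<in> verts G - S" "\<not> doubly_separates G (R \<union> S) x y"
    and "z \<in> verts G - S" "\<not> doubly_separates G (R \<union> S) x z"
  shows "y = z"
proof (rule ccontr)
  assume "y \<noteq> z"
  then have "doubly_separates G (R \<union> S) y z"
    by (rule resolving_equalizer_separates[OF assms(1,2,3,5)])
  moreover have "\<not> doubly_separates G (R \<union> S) y x"
    using assms(4) by (blast dest: doubly_separates_sym)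
  ultimately show False
    using not_doubly_separates_trans[OF _ assms(6)] by blast
qed

lemma doubly_resolving_extension:
  assumes conn: "Digraph_Component.connected G"
    and R: "resolving G R" and S: "distance_equalizer G S"
  shows "\<exists>T. doubly_resolving G T \<and> card T \<le> card R + 2 * card S"
proof -
  define bad where
    "bad x y \<longleftrightarrow> y \<in> verts G - S \<and> \<not> doubly_separates G (R \<union> S) x y" for x y
  \<comment> \<open>A vertex without a bad partner is sent to itself, which adds nothing new to the set.\<close>
  define f where "f x = (if \<exists>y. bad x y then SOME y. bad x y else x)" for x
  define T where "T = R \<union> S \<union> f ` S"
  have SV: "S \<subseteq> verts G" and RV: "R \<subseteq> verts G"
    using R S by (auto simp: resolving_def distance_equalizer_def)
  have f_bad: "bad x (f x)" if "bad x y" for x y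
    using that unfolding f_def by (auto intro: someI)
  have f_eq: "f x = y" if "bad x y" for x y
    using bad_partner_unique[OF R S, of "f x" x y] f_bad[OF that] that by (simp add: bad_def)
  have "f x \<in> verts G" if "x \<in> S" for x
  proof (cases "\<exists>y. bad x y")
    case True
    then show ?thesis using f_bad unfolding bad_def by blast
  next
    case False
    then show ?thesis using that SV unfolding f_def by auto
  qed
  then have TV: "T \<subseteq> verts G" using SV RV unfolding T_def by blast
  have mixed: "doubly_separates G T x y" if "x \<in> S" "y \<in> verts G - S" for x y
  proof (cases "bad x y")
    case True
    then have "x \<in> T" "y \<in> T" "x \<noteq> y"
      using f_eq that unfolding T_def by auto
    then show ?thesis using doubly_separates_members[OF conn TV] by blast
  next
    case False
    then have "doubly_separates G (R \<union> S) x y" using that unfolding bad_def by blast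
    then show ?thesis by (rule doubly_separates_mono) (simp add: T_def)
  qed
  have "doubly_separates G T x y" if "x \<in> verts G" "y \<in> verts G" "x \<noteq> y" for x y
  proof -
    consider "x \<in> S" "y \<in> S" | "x \<in> S" "y \<notin> S" | "x \<notin> S" "y \<in> S" | "x \<notin> S" "y \<notin> S"
      by blast
    then show ?thesis
    proof cases
      case 1
      then have "x \<in> T" "y \<in> T" unfolding T_def by auto
      then show ?thesis using doubly_separates_members[OF conn TV] that by blast
    next
      case 2
      then show ?thesis using mixed that by blast
    next
      case 3
      then show ?thesis using mixed that by (blast intro: doubly_separates_sym)
    next
      case 4
      then have "doubly_separates G (R \<union> S) x y"
        using resolving_equalizer_separates[OF R S] that by blast
      then show ?thesis by (rule doubly_separates_mono) (simp add: T_def)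
    qed
  qed
  then have "doubly_resolving G T" unfolding doubly_resolving_iff using TV by blast
  moreover have "card T \<le> card R + 2 * card S"
  proof -
    have "finite S" using SV finite_verts by (rule finite_subset)
    then have "card (f ` S) \<le> card S" by (rule card_image_le)
    then show ?thesis
      using card_Un_le[of "R \<union> S" "f ` S"] card_Un_le[of R S] unfolding T_def by linarith
  qed
  ultimately show ?thesis by blast
qed

end

theorem proposition17:
  fixes G :: "('a, 'b) pre_digraph"
  assumes "graph G" and "Digraph_Component.connected G"
  shows "psi G \<le> metric_dim G + 2 * eqdim G"
proof -
  interpret graph G by fact
  have "\<exists>R. resolving G R \<and> card R = metric_dim G"
    unfolding metric_dim_def by (rule LeastI_ex) (use resolving_verts[OF assms(2)] in blast)
  then obtain R where R: "resolving G R" "card R = metric_dim G" by blast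
  have "\<exists>S. distance_equalizer G S \<and> card S = eqdim G"
    unfolding eqdim_def by (rule LeastI_ex) (use distance_equalizer_verts in blast)
  then obtain S where S: "distance_equalizer G S" "card S = eqdim G" by blast
  obtain T where T: "doubly_resolving G T" "card T \<le> card R + 2 * card S"
    using doubly_resolving_extension[OF assms(2) R(1) S(1)] by blast
  have "psi G \<le> card T"
    unfolding psi_def by (rule Least_le) (use T(1) in blast)
  then show ?thesis using T(2) R(2) S(2) by simp
qed

end
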